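(* Let $G$ be a countable monoid and let $X$ be a $G$-act. Then the following conditions are equivalent: (1) $X$ admits a non-discrete Hausdorff $G$-topology; (2) $X$ admits a non-discrete metrizable $G$-topology; (3) the Zariski $G$-topology $\zeta_G$ on $X$ is non-discrete; (4) $X$ admits $2^{\mathfrak c}$ non-discrete hereditarily normal $G$-topologies.
   Context: Let $G$ be a monoid with two-sided unit $1_G$. A $G$-act is a set $X$ together with a map $G\times X\to X$, $(g,x)\mapsto g(x)$, such that $f(g(x))=(fg)(x)$ for all $f,g\in G$, $x\in X$, and $1_G(x)=x$ for all $x\in X$. A topology on $X$ is a $G$-topology if for every $g\in G$ the map $x\mapsto g(x)$ from $X$ to $X$ is continuous. The Zariski $G$-topology $\zeta_G$ on $X$ is the topology generated by the subbase consisting of all sets $\{x\in X: f(x)\ne g(x)\}$ and $\{x\in X: f(x)\ne c\}$, where $f,g\in G$ and $c\in X$. A topology is normal if it is $T_1$ and any two disjoint closed sets have disjoint open neighborhoods; it is hereditarily normal if every subspace is normal. $\mathfrak c=2^{\aleph_0}$ is the cardinality of the continuum. "Countable" means finite or countably infinite. "$X$ admits $N$ topologies with a property" means that there is a family of cardinality $N$ of pairwise distinct topologies on $X$ with this property. *)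

theory Defs
  imports "HOL-Analysis.Analysis" "HOL-Algebra.Group"
begin

locale monoid_act = monoid G for G (structure) +
  fixes X :: "'x set" and act :: "'g \<Rightarrow> 'x \<Rightarrow> 'x"
  assumes act_closed: "\<lbrakk>g \<in> carrier G; x \<in> X\<rbrakk> \<Longrightarrow> act g x \<in> X"
    and act_mult: "\<lbrakk>f \<in> carrier G; g \<in> carrier G; x \<in> X\<rbrakk> \<Longrightarrow> act f (act g x) = act (f \<otimes> g) x"
    and act_one: "x \<in> X \<Longrightarrow> act \<one> x = x"

definition act_topology ::
    "('g, 'm) monoid_scheme \<Rightarrow> 'x set \<Rightarrow> ('g \<Rightarrow> 'x \<Rightarrow> 'x) \<Rightarrow> 'x topology \<Rightarrow> bool"
  where "act_topology G X act T \<longleftrightarrow>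
    topspace T = X \<and> (\<forall>g\<in>carrier G. continuous_map T T (act g))"

text \<open>A subbase generates a topology on the whole of \<open>X\<close> (the empty intersection being \<open>X\<close>),
  whereas the space of \<open>topology_generated_by S\<close> is only \<open>\<Union>S\<close>. The two differ if \<open>X\<close> is a
  singleton, in which case all subbasic sets are empty; hence \<open>X\<close> is added explicitly.\<close>

definition zariski_topology ::
    "('g, 'm) monoid_scheme \<Rightarrow> 'x set \<Rightarrow> ('g \<Rightarrow> 'x \<Rightarrow> 'x) \<Rightarrow> 'x topology"
  where "zariski_topology G X act = topology_generated_by
    (insert X
      ({{x \<in> X. act f x \<noteq> act g x} | f g. f \<in> carrier G \<and> g \<in> carrier G} \<union>
       {{x \<in> X. act f x \<noteq> c} | f c. f \<in> carrier G \<and> c \<in> X}))"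

text \<open>The library's \<open>normal_space\<close> does not include the \<open>T\<^sub>1\<close> axiom.\<close>

definition hereditarily_normal :: "'x topology \<Rightarrow> bool"
  where "hereditarily_normal = hereditarily (\<lambda>T. t1_space T \<and> normal_space T)"

end

theory Submission
  imports Defs
begin

text \<open>
  Enumerate \<open>G\<close> as \<open>e\<^sub>0 = 1, e\<^sub>1, \<dots>\<close> and let \<open>a\<close> be non-isolated in the Zariski topology. Choose \<open>s\<^sub>n \<noteq> a\<close>
  recursively so that among \<open>e\<^sub>0, \<dots>, e\<^sub>n\<close> no coincidence \<open>e\<^sub>i s\<^sub>n = e\<^sub>j s\<^sub>n\<close>, \<open>e\<^sub>i s\<^sub>n = e\<^sub>j a\<close> or
  \<open>e\<^sub>i s\<^sub>n = e\<^sub>j s\<^sub>m\<close> with \<open>m < n\<close> occurs that does not persist when \<open>s\<^sub>n\<close> is replaced by \<open>a\<close>. Joining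
  \<open>e\<^sub>i a\<close> to \<open>e\<^sub>i s\<^sub>n\<close> for \<open>i \<le> n\<close>, whenever they differ, then gives a forest in which \<open>n\<close> increases
  along branches. For a free filter \<open>F\<close>, the finest act topology in which \<open>s\<close> converges to \<open>a\<close>
  along \<open>F\<close> is hereditarily normal, because separated sets are separated by the branches that stay
  inside the complement of the closure of the other set; moreover it determines \<open>F\<close>, and an almost
  disjoint family of size continuum yields \<open>2\<close> to the continuum many free filters. In these
  topologies the sets of descendants of a point are clopen, and their countably many preimages
  under \<open>G\<close> define an ultrametric on the countable subact generated by \<open>a\<close> and \<open>s\<close>; all other
  points are made isolated.
\<close>

section \<open>The finest act topology making a family converge\<close>

context monoid_act
begin

text \<open>Testing every translate of \<open>a\<close>, not just \<open>a\<close> itself, makes the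
  maps \<open>act g\<close> continuous. An act topology on \<open>X\<close> in which
  \<open>s\<close> converges to \<open>a\<close> along \<open>F\<close> has only open sets of this
  kind.\<close>

definition convergence_topology :: "'i filter \<Rightarrow> 'x \<Rightarrow> ('i \<Rightarrow> 'x) \<Rightarrow> 'x topology"
  where "convergence_topology F a s = topology (\<lambda>U. U \<subseteq> X \<and>
    (\<forall>g\<in>carrier G. act g a \<in> U \<longrightarrow> (\<forall>\<^sub>F i in F. act g (s i) \<in> U)))"

lemma openin_convergence_topology:
  "openin (convergence_topology F a s) U \<longleftrightarrow> U \<subseteq> X \<and>
    (\<forall>g\<in>carrier G. act g a \<in> U \<longrightarrow> (\<forall>\<^sub>F i in F. act g (s i) \<in> U))"
proof -
  have "istopology (\<lambda>U. U \<subseteq> X \<and>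
      (\<forall>g\<in>carrier G. act g a \<in> U \<longrightarrow> (\<forall>\<^sub>F i in F. act g (s i) \<in> U)))"
    unfolding istopology_def
  proof (intro conjI allI impI ballI; (elim conjE)?)
    fix S T g
    assume "\<forall>g\<in>carrier G. act g a \<in> S \<longrightarrow> (\<forall>\<^sub>F i in F. act g (s i) \<in> S)"
      and "\<forall>g\<in>carrier G. act g a \<in> T \<longrightarrow> (\<forall>\<^sub>F i in F. act g (s i) \<in> T)"
      and "g \<in> carrier G" "act g a \<in> S \<inter> T"
    then show "\<forall>\<^sub>F i in F. act g (s i) \<in> S \<inter> T"
      by (simp add: eventually_conj)
  next
    fix K g
    assume K: "\<forall>S\<in>K. S \<subseteq> X \<and>
        (\<forall>g\<in>carrier G. act g a \<in> S \<longrightarrow> (\<forall>\<^sub>F i in F. act g (s i) \<in> S))"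
      and g: "g \<in> carrier G" and "act g a \<in> \<Union>K"
    then obtain S where "S \<in> K" "act g a \<in> S" by blast
    then have "\<forall>\<^sub>F i in F. act g (s i) \<in> S" using K g by blast
    then show "\<forall>\<^sub>F i in F. act g (s i) \<in> \<Union>K"
      by eventually_elim (use \<open>S \<in> K\<close> in blast)
  qed blast+
  then show ?thesis
    by (simp add: convergence_topology_def topology_inverse')
qed

lemma topspace_convergence_topology:
  assumes "\<And>i. s i \<in> X"
  shows "topspace (convergence_topology F a s) = X"
proof (rule antisym)
  show "topspace (convergence_topology F a s) \<subseteq> X"
    using openin_convergence_topology openin_topspace by blast
  have "openin (convergence_topology F a s) X"
    using assms act_closed by (simp add: openin_convergence_topology)
  then show "X \<subseteq> topspace (convergence_topology F a s)"
    by (rule openin_subset)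
qed

lemma act_topology_convergence_topology:
  assumes "a \<in> X" "\<And>i. s i \<in> X"
  shows "act_topology G X act (convergence_topology F a s)"
proof -
  \<comment> \<open>The condition at \<open>f\<close> for the preimage under \<open>g\<close> is the
    condition at the product of \<open>g\<close> and \<open>f\<close> for \<open>U\<close>.\<close>
  have "openin (convergence_topology F a s) {x \<in> X. act g x \<in> U}"
    if "g \<in> carrier G" "openin (convergence_topology F a s) U" for g U
    using that assms act_closed
    by (auto simp: openin_convergence_topology act_mult)
  then show ?thesis
    using assms act_closed
    by (auto simp: act_topology_def continuous_map_def topspace_convergence_topology)
qed

lemma convergence_topology_nondiscrete:
  assumes "a \<in> X" "F \<noteq> bot" "\<And>i. s i \<in> X - {a}"
  shows "convergence_topology F a s \<noteq> discrete_topology X"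
proof
  assume "convergence_topology F a s = discrete_topology X"
  then have "openin (convergence_topology F a s) {a}"
    using assms(1) by simp
  then have "\<forall>\<^sub>F i in F. act \<one> (s i) = a"
    using assms(1) act_one one_closed unfolding openin_convergence_topology by auto
  then have "\<forall>\<^sub>F i in F. False"
    by eventually_elim (use assms(3) act_one in auto)
  then show False
    using assms(2) by (simp add: eventually_False)
qed

end

section \<open>Generic sequences and the forest they span\<close>

text \<open>Bounding the indices by \<open>n\<close> leaves finitely many conditions on each
  \<open>s n\<close>, as a non-isolated point can satisfy, while any given \<open>e i\<close> is
  covered by all but finitely many \<open>n\<close>.\<close>

locale generic_sequence = monoid_act G X act
  for G (structure) and X :: "'x set" and act :: "'g \<Rightarrow> 'x \<Rightarrow> 'x" +
  fixes e :: "nat \<Rightarrow> 'g" and a :: 'x and s :: "nat \<Rightarrow> 'x"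
  assumes range_e: "range e = carrier G" and e0: "e 0 = \<one>"
    and a_in: "a \<in> X" and s_in: "s n \<in> X" and s_ne: "s n \<noteq> a"
    and sep_e: "\<lbrakk>i \<le> n; j \<le> n; act (e i) (s n) = act (e j) (s n)\<rbrakk>
      \<Longrightarrow> act (e i) a = act (e j) a"
    and sep_a: "\<lbrakk>i \<le> n; j \<le> n; act (e i) (s n) = act (e j) a\<rbrakk>
      \<Longrightarrow> act (e i) a = act (e j) a"
    and sep_s: "\<lbrakk>i \<le> n; j \<le> n; m < n; act (e i) (s n) = act (e j) (s m)\<rbrakk>
      \<Longrightarrow> act (e i) a = act (e j) (s m)"
begin

lemma e_in: "e i \<in> carrier G"
  using range_e by blast

definition child :: "nat \<Rightarrow> 'x \<Rightarrow> 'x \<Rightarrow> bool"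
  where "child n y w \<longleftrightarrow> (\<exists>i\<le>n. y = act (e i) a \<and> w = act (e i) (s n) \<and> w \<noteq> y)"

lemma child_in: "child n y w \<Longrightarrow> y \<in> X \<and> w \<in> X"
  using act_closed e_in a_in s_in by (auto simp: child_def)

text \<open>If the indices differed, \<open>sep_s\<close> at the larger one would identify
  \<open>w\<close> with its own parent; for equal indices \<open>sep_e\<close> identifies the two
  parents.\<close>

lemma child_unique:
  assumes "child n y w" "child m z w"
  shows "n = m" "y = z"
proof -
  have *: "\<not> m < n" if "child n y w" "child m z w" for n m y z
    using that sep_s unfolding child_def by (metis le_less_trans less_imp_le)
  show "n = m"
    using *[OF assms] *[OF assms(2,1)] by simp
  then show "y = z"
    using assms sep_e unfolding child_def by metis
qed

text \<open>If \<open>n \<le> m\<close>, both representations of \<open>y\<close> fall within the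
  range of \<open>sep_a\<close> at \<open>m\<close>, which makes \<open>y\<close> equal to its
  parent.\<close>

lemma child_level_less:
  assumes "child n y w" "child m z y"
  shows "m < n"
proof (rule ccontr)
  assume "\<not> m < n"
  moreover obtain i where "i \<le> n" "y = act (e i) a"
    using assms(1) by (auto simp: child_def)
  moreover obtain j where "j \<le> m" "y = act (e j) (s m)" "y \<noteq> act (e j) a"
    using assms(2) by (auto simp: child_def)
  ultimately show False
    using sep_a[of j m i] by simp
qed

lemma child_s: "child n a (s n)"
  unfolding child_def using e0 a_in s_in s_ne by (metis act_one le0)

text \<open>Roots get level 0; the shift by one makes edges leaving a root raise the level too, even
  those of index 0.\<close>

definition level :: "'x \<Rightarrow> nat"
  where "level w = (if \<exists>n y. child n y w then Suc (THE n. \<exists>y. child n y w) else 0)"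

lemma level_child: "child n y w \<Longrightarrow> level w = Suc n"
proof -
  assume c: "child n y w"
  then have "(THE n. \<exists>y. child n y w) = n"
    using child_unique(1) by blast
  then show ?thesis using c by (auto simp: level_def)
qed

text \<open>Only the child must lie in \<open>W\<close>, which suffices to keep paths that start in
  \<open>W\<close> inside \<open>W\<close>.\<close>

definition edges :: "'x set \<Rightarrow> ('x \<times> 'x) set"
  where "edges W = {(y, w). w \<in> W \<and> (\<exists>n. child n y w)}"

lemma edges_level: "(y, w) \<in> edges W \<Longrightarrow> level y < level w"
proof -
  assume "(y, w) \<in> edges W"
  then obtain n where n: "child n y w" by (auto simp: edges_def)
  show ?thesis
  proof (cases "\<exists>m z. child m z y")
    case True
    then show ?thesis using n child_level_less level_child by fastforce
  next
    case False
    then show ?thesis using n level_child by (auto simp: level_def)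
  qed
qed

lemma edges_rtrancl_level: "(y, w) \<in> (edges W)\<^sup>* \<Longrightarrow> y = w \<or> level y < level w"
  by (induction rule: rtrancl_induct) (auto dest: edges_level)

lemma edges_rtrancl_in: "(y, w) \<in> (edges W)\<^sup>* \<Longrightarrow> y \<in> W \<Longrightarrow> w \<in> W"
  by (induction rule: rtrancl_induct) (auto simp: edges_def)

lemma edges_parent_unique: "(y, w) \<in> edges V \<Longrightarrow> (z, w) \<in> edges W \<Longrightarrow> y = z"
  using child_unique(2) by (auto simp: edges_def)

section \<open>Open sets of the convergence topology in terms of the forest\<close>

abbreviation T :: "nat filter \<Rightarrow> 'x topology"
  where "T F \<equiv> convergence_topology F a s"

lemma openin_T:
  "openin (T F) U \<longleftrightarrow> U \<subseteq> X \<and> (\<forall>i. act (e i) a \<in> U \<longrightarrow> (\<forall>\<^sub>F n in F. act (e i) (s n) \<in> U))"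
  unfolding openin_convergence_topology range_e[symmetric] by auto

lemma topspace_T: "topspace (T F) = X"
  using s_in by (rule topspace_convergence_topology)

text \<open>As \<open>F\<close> is free, \<open>i \<le> n\<close> holds eventually, and then
  \<open>act (e i) (s n)\<close> is either \<open>act (e i) a\<close> itself or a child of
  it.\<close>

lemma openin_T_childI:
  assumes F: "F \<le> sequentially" and U: "U \<subseteq> X"
    and step: "\<And>y. y \<in> U \<Longrightarrow> \<forall>\<^sub>F n in F. \<forall>w. child n y w \<longrightarrow> w \<in> U"
  shows "openin (T F) U"
  unfolding openin_T
proof (intro conjI allI impI U)
  fix i assume i: "act (e i) a \<in> U"
  have "\<forall>\<^sub>F n in F. i \<le> n"
    using F eventually_ge_at_top filter_leD by blast
  with step[OF i] show "\<forall>\<^sub>F n in F. act (e i) (s n) \<in> U"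
  proof eventually_elim
    case (elim n)
    then show ?case
      using i by (cases "act (e i) (s n) = act (e i) a") (auto simp: child_def)
  qed
qed

text \<open>Openness of \<open>W\<close> puts the relevant children eventually into
  \<open>W\<close>, so the edges leading to them are edges of \<open>W\<close> and prolong the
  branches.\<close>

lemma openin_descendants:
  assumes F: "F \<le> sequentially" and W: "openin (T F) W" and A: "A \<subseteq> W"
  shows "openin (T F) ((edges W)\<^sup>* `` A)"
  unfolding openin_T
proof (intro conjI allI impI)
  show sub: "(edges W)\<^sup>* `` A \<subseteq> X"
    using A W edges_rtrancl_in openin_subset topspace_T by fast
  fix i assume i: "act (e i) a \<in> (edges W)\<^sup>* `` A"
  then have "act (e i) a \<in> W"
    using A edges_rtrancl_in by blast
  then have "\<forall>\<^sub>F n in F. act (e i) (s n) \<in> W"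
    using W openin_T by blast
  moreover have "\<forall>\<^sub>F n in F. i \<le> n"
    using F eventually_ge_at_top filter_leD by blast
  ultimately show "\<forall>\<^sub>F n in F. act (e i) (s n) \<in> (edges W)\<^sup>* `` A"
  proof eventually_elim
    case (elim n)
    show ?case
    proof (cases "act (e i) (s n) = act (e i) a")
      case True
      then show ?thesis using i by simp
    next
      case False
      then have "(act (e i) a, act (e i) (s n)) \<in> edges W"
        using elim by (auto simp: edges_def child_def)
      then show ?thesis using i by (meson Image_iff rtrancl.rtrancl_into_rtrancl)
    qed
  qed
qed

text \<open>All edges into \<open>w\<close> carry the one index \<open>n\<close> with
  \<open>level w = Suc n\<close>, and a free filter avoids a single index.\<close>

lemma eventually_not_child:
  assumes F: "F \<le> sequentially"
  shows "\<forall>\<^sub>F n in F. \<forall>y. \<not> child n y w"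
proof -
  have "\<forall>\<^sub>F n in F. level w \<le> n"
    using F eventually_ge_at_top filter_leD by blast
  then show ?thesis
    by eventually_elim (auto dest: level_child)
qed

lemma t1_space_T:
  assumes F: "F \<le> sequentially"
  shows "t1_space (T F)"
proof -
  have "openin (T F) (X - {w})" for w
  proof (rule openin_T_childI[OF F])
    fix y assume "y \<in> X - {w}"
    from eventually_not_child[OF F, of w]
    show "\<forall>\<^sub>F n in F. \<forall>v. child n y v \<longrightarrow> v \<in> X - {w}"
      by eventually_elim (use child_in in blast)
  qed blast
  then show ?thesis
    by (simp add: t1_space_closedin_singleton closedin_def topspace_T)
qed

text \<open>Two branches meeting at \<open>w\<close> lie on the same path towards the root, so the
  starting point of one of them is passed by the other.\<close>

lemma branches_meet:
  assumes "(u, w) \<in> (edges U)\<^sup>*" "(v, w) \<in> (edges V)\<^sup>*" "u \<in> U" "v \<in> V"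
  shows "u \<in> V \<or> v \<in> U"
  using assms(1,2)
proof (induction rule: rtrancl_induct)
  case base
  then show ?case using assms(4) edges_rtrancl_in by blast
next
  case (step y z)
  from step.prems show ?case
  proof (cases rule: rtranclE)
    case base
    then show ?thesis using step.hyps by (auto simp: edges_def)
  next
    case (step y')
    then show ?thesis
      using step.IH \<open>(y, z) \<in> edges U\<close> edges_parent_unique by blast
  qed
qed

lemma hereditarily_normal_T:
  assumes F: "F \<le> sequentially"
  shows "hereditarily_normal (T F)"
proof -
  have "hereditarily normal_space (T F)"
    unfolding hereditarily_normal_separation
  proof (intro allI impI)
    fix A B assume AB: "separatedin (T F) A B"
    \<comment> \<open>\<open>U\<close> is an open set around \<open>A\<close> missing
      \<open>B\<close>, and \<open>V\<close> one around \<open>B\<close> missing \<open>A\<close>.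
      If branches from \<open>A\<close> in \<open>U\<close> and from \<open>B\<close> in
      \<open>V\<close> met, a starting point of one would lie in the other open set.\<close>
    define U V where "U = X - T F closure_of B" and "V = X - T F closure_of A"
    have sub: "A \<subseteq> U" "B \<subseteq> V"
      using AB by (auto simp: U_def V_def separatedin_def topspace_T)
    have dis: "U \<inter> B = {}" "V \<inter> A = {}"
      using AB closure_of_subset unfolding U_def V_def separatedin_def by fastforce+
    have "openin (T F) U" "openin (T F) V"
      unfolding U_def V_def using topspace_T by (metis closedin_closure_of openin_diff openin_topspace)+
    then have "openin (T F) ((edges U)\<^sup>* `` A)" "openin (T F) ((edges V)\<^sup>* `` B)"
      using openin_descendants F sub by blast+
    moreover have "disjnt ((edges U)\<^sup>* `` A) ((edges V)\<^sup>* `` B)"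
      unfolding disjnt_iff
    proof (intro allI notI; elim conjE ImageE)
      fix w u v
      assume *: "(u, w) \<in> (edges U)\<^sup>*" "(v, w) \<in> (edges V)\<^sup>*" and uv: "u \<in> A" "v \<in> B"
      then have "u \<in> V \<or> v \<in> U"
        using sub by (intro branches_meet[OF *]) auto
      then show False
        using uv dis by auto
    qed
    ultimately show "\<exists>U V. openin (T F) U \<and> openin (T F) V \<and> A \<subseteq> U \<and> B \<subseteq> V \<and> disjnt U V"
      by blast
  qed
  then show ?thesis
    using t1_space_T[OF F] by (simp add: hereditarily_normal_def hereditarily t1_space_subtopology)
qed

text \<open>The set \<open>U\<close> of \<open>a\<close>, its children with index in
  \<open>P\<close>, and all their descendants is open for \<open>F\<close>, yet contains
  \<open>s n\<close> only if \<open>P n\<close>. Its openness for \<open>F'\<close> therefore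
  transfers \<open>P\<close>.\<close>

lemma eventually_T_eq:
  assumes F: "F \<le> sequentially" and eq: "T F = T F'" and P: "eventually P F"
  shows "eventually P F'"
proof -
  define S where "S = {w. \<exists>n. child n a w \<and> P n}"
  define U where "U = insert a ((edges X)\<^sup>* `` S)"
  have U: "U \<subseteq> X"
    using a_in child_in edges_rtrancl_in by (fastforce simp: U_def S_def)
  have "openin (T F) U"
  proof (rule openin_T_childI[OF F U])
    fix y assume y: "y \<in> U"
    from P show "\<forall>\<^sub>F n in F. \<forall>w. child n y w \<longrightarrow> w \<in> U"
    proof eventually_elim
      case (elim n)
      show ?case
      proof (intro allI impI)
        fix w assume w: "child n y w"
        then have "(y, w) \<in> edges X" using child_in by (auto simp: edges_def)
        moreover have "y = a \<or> y \<in> (edges X)\<^sup>* `` S" using y U_def by blast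
        ultimately show "w \<in> U"
          using w elim unfolding U_def S_def by (auto intro: rtrancl_into_rtrancl)
      qed
    qed
  qed
  then have "openin (T F') U" by (simp only: eq)
  moreover have "act (e 0) a \<in> U" using e0 a_in act_one by (simp add: U_def)
  ultimately have "\<forall>\<^sub>F n in F'. act (e 0) (s n) \<in> U" using openin_T by blast
  then show ?thesis
  proof eventually_elim
    case (elim n)
    then have "s n \<in> U" using e0 s_in act_one by simp
    then obtain w m where w: "(w, s n) \<in> (edges X)\<^sup>*" "child m a w" "P m"
      using s_ne by (auto simp: U_def S_def)
    \<comment> \<open>The parent of \<open>s n\<close> is \<open>a\<close>, so a nontrivial path
      from \<open>w\<close> would pass through \<open>a\<close>, whose level is smaller than that of
      \<open>w\<close>.\<close>
    from w(1) have "w = s n"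
    proof (cases rule: rtranclE)
      case (step v)
      then have "v = a"
        by (auto simp: edges_def intro: child_unique(2)[OF _ child_s])
      then have "w = a \<or> level w < level a"
        using step edges_rtrancl_level by blast
      moreover have "level a < level w"
        using w(2) child_in by (intro edges_level[of _ _ X]) (auto simp: edges_def)
      ultimately show ?thesis by auto
    qed
    then show "P n"
      using w child_s child_unique(1) by blast
  qed
qed

lemma inj_on_T: "inj_on T {F. F \<le> sequentially}"
  by (rule inj_onI) (metis (mono_tags, lifting) eventually_T_eq filter_eq_iff mem_Collect_eq)

section \<open>Clopen sets of descendants\<close>

definition descendants :: "'x \<Rightarrow> 'x set"
  where "descendants y = (edges X)\<^sup>* `` {y}"

lemma self_descendant: "y \<in> descendants y"
  by (simp add: descendants_def)

text \<open>Levels rise strictly along nontrivial paths. Consequently sets of descendants separate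
  points.\<close>

lemma descendants_antisym:
  assumes "v \<in> descendants w" "w \<in> descendants v"
  shows "v = w"
proof -
  have "(w, v) \<in> (edges X)\<^sup>*" "(v, w) \<in> (edges X)\<^sup>*"
    using assms by (auto simp: descendants_def)
  then show ?thesis
    by (auto dest!: edges_rtrancl_level)
qed

lemma clopen_descendants:
  assumes F: "F \<le> sequentially" and y: "y \<in> X"
  shows "openin (T F) (descendants y)" "openin (T F) (X - descendants y)"
proof -
  show "openin (T F) (descendants y)"
    unfolding descendants_def
    using openin_descendants[OF F, of X "{y}"] y topspace_T by (metis empty_subsetI insert_subset openin_topspace)
  show "openin (T F) (X - descendants y)"
  proof (rule openin_T_childI[OF F])
    fix z assume z: "z \<in> X - descendants y"
    from eventually_not_child[OF F, of y]
    show "\<forall>\<^sub>F n in F. \<forall>w. child n z w \<longrightarrow> w \<in> X - descendants y"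
    proof eventually_elim
      case (elim n)
      show ?case
      proof (intro allI impI)
        fix w assume w: "child n z w"
        \<comment> \<open>The unique parent \<open>z\<close> of \<open>w\<close> is no descendant of
          \<open>y\<close>, so only \<open>w = y\<close> is possible, which is eventually
          excluded.\<close>
        have "w \<notin> descendants y"
        proof
          assume "w \<in> descendants y"
          then have "(y, w) \<in> (edges X)\<^sup>*" by (simp add: descendants_def)
          then show False
          proof (cases rule: rtranclE)
            case base
            then show ?thesis using w elim by blast
          next
            case (step v)
            then have "v = z" using w child_unique(2) by (auto simp: edges_def)
            then show ?thesis using step z by (simp add: descendants_def)
          qed
        qed
        then show "w \<in> X - descendants y" using w child_in by blast
      qed
    qed
  qed blast
qed

end

section \<open>A metrizable topology from a countable separating family\<close>

text \<open>Points of \<open>Y\<close> are compared by the first \<open>B k\<close> that separates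
  them, as in a Cantor space. \<open>preimage\<close> yields continuity of the action, and
  \<open>limit\<close> keeps \<open>a\<close> from being isolated.\<close>

lemma (in monoid_act) metrizable_act_topology_from_sets:
  fixes B :: "nat \<Rightarrow> 'x set"
  assumes YX: "Y \<subseteq> X" and Y_closed: "\<And>g y. \<lbrakk>g \<in> carrier G; y \<in> Y\<rbrakk> \<Longrightarrow> act g y \<in> Y"
    and preimage: "\<And>g k. g \<in> carrier G \<Longrightarrow> \<exists>j. \<forall>y\<in>Y. act g y \<in> B k \<longleftrightarrow> y \<in> B j"
    and separating: "\<And>x y. \<lbrakk>x \<in> Y; y \<in> Y; \<And>k. x \<in> B k \<longleftrightarrow> y \<in> B k\<rbrakk> \<Longrightarrow> x = y"
    and a: "a \<in> Y"
    and limit: "\<And>K. \<exists>y\<in>Y - {a}. \<forall>k\<le>K. y \<in> B k \<longleftrightarrow> a \<in> B k"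
  shows "\<exists>T. act_topology G X act T \<and> T \<noteq> discrete_topology X \<and> metrizable_space T"
proof -
  define split where "split x y k \<longleftrightarrow> (x \<in> B k \<longleftrightarrow> y \<notin> B k)" for x y k
  define d :: "'x \<Rightarrow> 'x \<Rightarrow> real" where
    "d x y = (if x = y then 0 else if x \<in> Y \<and> y \<in> Y
      then inverse (real (Suc (LEAST k. split x y k))) else 1)" for x y
  have split_ex: "\<exists>k. split x y k" if "x \<in> Y" "y \<in> Y" "x \<noteq> y" for x y
    using separating that by (auto simp: split_def)
  have split_comm: "split x y = split y x" for x y
    by (auto simp: split_def)
  have d_le_1: "d x y \<le> 1" for x y
    by (simp add: d_def inverse_le_1_iff)
  have d_ge: "inverse (real (Suc k)) \<le> d x y" if "x \<in> Y" "y \<in> Y" "split x y k" for x y k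
  proof -
    have "x \<noteq> y" using that(3) by (auto simp: split_def)
    then show ?thesis
      using that Least_le[of "split x y" k] by (simp add: d_def)
  qed
  \<comment> \<open>Small balls within \<open>Y\<close> amount to agreement on an initial segment of
    the sets \<open>B k\<close>.\<close>
  have d_less: "d x y < inverse (real (Suc K)) \<longleftrightarrow> (\<forall>k\<le>K. \<not> split x y k)"
    if xy: "x \<in> Y" "y \<in> Y" for x y K
  proof
    assume less: "d x y < inverse (real (Suc K))"
    show "\<forall>k\<le>K. \<not> split x y k"
    proof (intro allI impI notI)
      fix k assume "k \<le> K" "split x y k"
      then have "inverse (real (Suc K)) \<le> inverse (real (Suc k))" by simp
      then show False
        using d_ge[OF xy \<open>split x y k\<close>] less by linarith
    qed
  next
    assume none: "\<forall>k\<le>K. \<not> split x y k"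
    show "d x y < inverse (real (Suc K))"
    proof (cases "x = y")
      case True
      then show ?thesis by (simp add: d_def)
    next
      case False
      then have "split x y (LEAST k. split x y k)"
        using split_ex xy by (meson LeastI_ex)
      then have "K < (LEAST k. split x y k)"
        using none not_le by blast
      then show ?thesis
        using False xy by (simp add: d_def)
    qed
  qed
  have ultra: "d x z \<le> max (d x y) (d y z)" for x y z
  proof (cases "x = y \<or> y = z \<or> x = z")
    case True
    then show ?thesis by (auto simp: d_def le_max_iff_disj)
  next
    case neq: False
    show ?thesis
    proof (cases "x \<in> Y \<and> y \<in> Y \<and> z \<in> Y")
      case True
      define k where "k = (LEAST k. split x z k)"
      have "split x z k"
        unfolding k_def using split_ex True neq by (meson LeastI_ex)
      then have "split x y k \<or> split y z k"
        by (auto simp: split_def)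
      then have "inverse (real (Suc k)) \<le> max (d x y) (d y z)"
        using d_ge True by (metis le_max_iff_disj)
      then show ?thesis
        using True neq by (simp add: d_def k_def)
    next
      case False
      then have "d x y = 1 \<or> d y z = 1 \<or> d x z = 1 \<and> (x \<notin> Y \<or> z \<notin> Y)"
        using neq by (auto simp: d_def)
      moreover have "d x y = 1" if "x \<notin> Y" using that neq by (simp add: d_def)
      moreover have "d y z = 1" if "z \<notin> Y" using that neq by (simp add: d_def)
      ultimately show ?thesis
        using d_le_1[of x z] by (auto simp: le_max_iff_disj)
    qed
  qed
  have d_nonneg: "0 \<le> d x y" for x y
    by (simp add: d_def)
  interpret Metric_space X d
  proof
    show "d x y = d y x" for x y
      by (auto simp: d_def split_comm)
    show "d x y = 0 \<longleftrightarrow> x = y" for x y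
      by (simp add: d_def)
    show "d x z \<le> d x y + d y z" for x y z
      using ultra[of x z y] d_nonneg[of x y] d_nonneg[of y z] by linarith
  qed (rule d_nonneg)
  have cont: "openin mtopology {x \<in> X. act g x \<in> U}"
    if g: "g \<in> carrier G" and U: "openin mtopology U" for g U
    unfolding openin_mtopology
  proof (intro conjI allI impI)
    fix x assume x: "x \<in> {x \<in> X. act g x \<in> U}"
    then obtain r where r: "r > 0" "mball (act g x) r \<subseteq> U"
      using U openin_mtopology by blast
    show "\<exists>r>0. mball x r \<subseteq> {x \<in> X. act g x \<in> U}"
    proof (cases "x \<in> Y")
      case False
      \<comment> \<open>Points outside \<open>Y\<close> are at distance 1 from all others, hence
        isolated.\<close>
      have "mball x 1 \<subseteq> {x}"
        using False by (auto simp: in_mball d_def split: if_splits)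
      then show ?thesis
        using x by (intro exI[of _ 1]) auto
    next
      case True
      obtain K where K: "inverse (real (Suc K)) < r"
        using reals_Archimedean r(1) by blast
      obtain j where j: "\<And>k y. y \<in> Y \<Longrightarrow> act g y \<in> B k \<longleftrightarrow> y \<in> B (j k)"
        using preimage[OF g] by metis
      \<comment> \<open>Agreement up to \<open>J\<close> covers the preimages of all
        \<open>B k\<close> with \<open>k \<le> K\<close>.\<close>
      define J where "J = Max (j ` {..K})"
      have "mball x (inverse (real (Suc J))) \<subseteq> {x \<in> X. act g x \<in> U}"
      proof
        fix y assume "y \<in> mball x (inverse (real (Suc J)))"
        then have y: "y \<in> X" "d x y < inverse (real (Suc J))" by (auto simp: in_mball)
        moreover have "inverse (real (Suc J)) \<le> 1" by (simp add: inverse_le_1_iff)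
        ultimately have "y \<in> Y"
          using True by (auto simp: d_def split: if_splits)
        have "\<not> split (act g x) (act g y) k" if "k \<le> K" for k
        proof -
          have "j k \<le> J" unfolding J_def using that by simp
          then have "\<not> split x y (j k)"
            using d_less[OF True \<open>y \<in> Y\<close>] y(2) by blast
          then show ?thesis using j True \<open>y \<in> Y\<close> by (simp add: split_def)
        qed
        then have "d (act g x) (act g y) < inverse (real (Suc K))"
          using d_less Y_closed g True \<open>y \<in> Y\<close> by blast
        then have "act g y \<in> mball (act g x) r"
          using K x y(1) g act_closed by (auto simp: in_mball)
        then show "y \<in> {x \<in> X. act g x \<in> U}" using r(2) y(1) by blast
      qed
      then show ?thesis
        by (intro exI[of _ "inverse (real (Suc J))"]) simp
    qed
  qed blast
  have "\<not> openin mtopology {a}"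
  proof
    assume "openin mtopology {a}"
    then obtain r where r: "r > 0" "mball a r \<subseteq> {a}"
      unfolding openin_mtopology by blast
    then obtain K where K: "inverse (real (Suc K)) < r"
      using reals_Archimedean by blast
    obtain y where y: "y \<in> Y - {a}" "\<forall>k\<le>K. y \<in> B k \<longleftrightarrow> a \<in> B k"
      using limit by blast
    then have "d a y < inverse (real (Suc K))"
      using d_less[of a y K] a by (auto simp: split_def)
    then have "y \<in> mball a r"
      using K y a YX by (auto simp: in_mball)
    then show False using r(2) y(1) by blast
  qed
  then have "mtopology \<noteq> discrete_topology X"
    using a YX by auto
  moreover have "act_topology G X act mtopology"
    using cont act_closed by (auto simp: act_topology_def continuous_map_def)
  ultimately show ?thesis
    using metrizable_space_mtopology by blast
qed

section \<open>Metrizability from a generic sequence\<close>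

context generic_sequence
begin

lemma ex_metrizable:
  "\<exists>T. act_topology G X act T \<and> T \<noteq> discrete_topology X \<and> metrizable_space T"
proof -
  define Y where "Y = (\<Union>i. (\<lambda>x. act (e i) x) ` insert a (range s))"
  have YX: "Y \<subseteq> X"
    using act_closed e_in a_in s_in by (auto simp: Y_def)
  have "countable Y"
    by (simp add: Y_def)
  have mem_Y: "act g x \<in> Y" if "g \<in> carrier G" "x \<in> insert a (range s)" for g x
    using that unfolding Y_def range_e[symmetric] by blast
  have s_Y: "s n \<in> Y" for n
    using mem_Y[of \<one> "s n"] s_in by (simp add: act_one)
  have a_Y: "a \<in> Y"
    using mem_Y[of \<one> a] a_in by (simp add: act_one)
  have Y_closed: "act g y \<in> Y" if g: "g \<in> carrier G" and "y \<in> Y" for g y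
  proof -
    obtain i x where x: "y = act (e i) x" "x \<in> insert a (range s)"
      using \<open>y \<in> Y\<close> unfolding Y_def by blast
    then have "act g y = act (g \<otimes> e i) x"
      using g e_in a_in s_in act_mult by auto
    then show ?thesis
      using mem_Y x(2) g e_in by simp
  qed
  \<comment> \<open>Preimages under the monoid of the descendant sets of points of \<open>Y\<close>:
    countably many because \<open>Y\<close> is countable, and stable under further preimages because
    each product \<open>e i \<otimes> g\<close> is some \<open>e m\<close>.\<close>
  define B where "B k = (case prod_decode k of (i, j) \<Rightarrow>
      {x \<in> X. act (e i) x \<in> descendants (from_nat_into Y j)})" for k
  have B: "B (prod_encode (i, j)) = {x \<in> X. act (e i) x \<in> descendants (from_nat_into Y j)}" for i j
    by (simp add: B_def)
  \<comment> \<open>In the topology for the full filter \<open>sequentially\<close> each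
    \<open>B k\<close> is clopen, so \<open>s n\<close> eventually lies on the same side of
    \<open>B k\<close> as \<open>a\<close>.\<close>
  have act_top: "act_topology G X act (T sequentially)"
    using a_in s_in by (rule act_topology_convergence_topology)
  have clopen: "openin (T sequentially) (B k)" "openin (T sequentially) (X - B k)" for k
  proof -
    obtain i j where k: "k = prod_encode (i, j)"
      by (metis prod.exhaust prod_decode_inverse)
    have "from_nat_into Y j \<in> X"
      using from_nat_into[of Y j] a_Y YX by blast
    note cl = clopen_descendants[OF order_refl this]
    have cont: "continuous_map (T sequentially) (T sequentially) (act (e i))"
      using act_top e_in by (simp add: act_topology_def)
    from openin_continuous_map_preimage[OF cont cl(1)]
    show "openin (T sequentially) (B k)"
      by (simp add: k B topspace_T)
    from openin_continuous_map_preimage[OF cont cl(2)]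
    have "openin (T sequentially)
        {x \<in> X. act (e i) x \<in> X - descendants (from_nat_into Y j)}"
      by (simp add: topspace_T)
    also have "{x \<in> X. act (e i) x \<in> X - descendants (from_nat_into Y j)} = X - B k"
      using e_in act_closed by (auto simp: k B)
    finally show "openin (T sequentially) (X - B k)" .
  qed
  show ?thesis
  proof (rule metrizable_act_topology_from_sets[OF YX Y_closed _ _ a_Y, of B])
    fix g k assume g: "g \<in> carrier G"
    obtain i j where k: "k = prod_encode (i, j)"
      by (metis prod.exhaust prod_decode_inverse)
    have "e i \<otimes> g \<in> carrier G"
      using g e_in by simp
    then obtain m where m: "e m = e i \<otimes> g"
      using range_e by (metis imageE)
    have "act g y \<in> B k \<longleftrightarrow> y \<in> B (prod_encode (m, j))" if "y \<in> Y" for y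
    proof -
      have "y \<in> X" using that YX by blast
      then show ?thesis
        using g e_in act_closed by (simp add: k B m act_mult)
    qed
    then show "\<exists>j. \<forall>y\<in>Y. act g y \<in> B k \<longleftrightarrow> y \<in> B j" by blast
  next
    fix x y assume xy: "x \<in> Y" "y \<in> Y" and eq: "\<And>k. x \<in> B k \<longleftrightarrow> y \<in> B k"
    have "x \<in> descendants z \<longleftrightarrow> y \<in> descendants z" if "z \<in> Y" for z
    proof -
      obtain j where j: "from_nat_into Y j = z"
        using from_nat_into_surj \<open>countable Y\<close> \<open>z \<in> Y\<close> by metis
      have "x \<in> X" "y \<in> X"
        using xy YX by auto
      then show ?thesis
        \<comment> \<open>As \<open>e 0\<close> is the unit, the descendant sets themselves occur
          among the \<open>B k\<close>.\<close>
        using eq[of "prod_encode (0, j)"] by (simp add: B j e0 act_one)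
    qed
    then show "x = y"
      using xy self_descendant descendants_antisym by metis
  next
    fix K
    have "openin (T sequentially) (if a \<in> B k then B k else X - B k)" for k
      using clopen by simp
    moreover have "act (e 0) a \<in> (if a \<in> B k then B k else X - B k)" for k
      using e0 a_in act_one by simp
    ultimately have "\<forall>\<^sub>F n in sequentially. act (e 0) (s n) \<in> (if a \<in> B k then B k else X - B k)" for k
      using openin_T by blast
    then have "\<forall>\<^sub>F n in sequentially. s n \<in> B k \<longleftrightarrow> a \<in> B k" for k
      by (rule eventually_mono) (auto simp: e0 s_in act_one split: if_splits)
    then have "\<forall>\<^sub>F n in sequentially. \<forall>k\<in>{..K}. s n \<in> B k \<longleftrightarrow> a \<in> B k"
      by (intro eventually_ball_finite) auto
    then obtain n where "\<forall>k\<in>{..K}. s n \<in> B k \<longleftrightarrow> a \<in> B k"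
      using eventually_happens trivial_limit_sequentially by blast
    then show "\<exists>y\<in>Y - {a}. \<forall>k\<le>K. y \<in> B k \<longleftrightarrow> a \<in> B k"
      using s_Y s_ne by (intro bexI[of _ "s n"]) auto
  qed
qed

end

section \<open>Generic sequences at non-isolated points of the Zariski topology\<close>

context monoid_act
begin

lemma topspace_zariski: "topspace (zariski_topology G X act) = X"
  unfolding zariski_topology_def topology_generated_by_topspace by blast

text \<open>Each single condition holds on all of \<open>X\<close> or on a subbasic set. The finite
  intersection is an open set containing \<open>a\<close>, hence has another point.\<close>

lemma zariski_nonisolated:
  assumes "a \<in> X" "\<not> openin (zariski_topology G X act) {a}"
    and I: "finite I" "I \<subseteq> carrier G" and C: "finite C" "C \<subseteq> X"
  shows "\<exists>x\<in>X - {a}. (\<forall>f\<in>I. \<forall>g\<in>I. act f x = act g x \<longrightarrow> act f a = act g a) \<and>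
    (\<forall>f\<in>I. \<forall>c\<in>C. act f x = c \<longrightarrow> act f a = c)"
proof -
  define U where "U f g = {x \<in> X. act f x = act g x \<longrightarrow> act f a = act g a}" for f g
  define V where "V f c = {x \<in> X. act f x = c \<longrightarrow> act f a = c}" for f c
  let ?Z = "zariski_topology G X act"
  have X: "openin ?Z X"
    by (metis openin_topspace topspace_zariski)
  have U: "openin ?Z (U f g)" if "f \<in> I" "g \<in> I" for f g
  proof (cases "act f a = act g a")
    case True
    then show ?thesis using X by (simp add: U_def)
  next
    case False
    then have "U f g = {x \<in> X. act f x \<noteq> act g x}" by (auto simp: U_def)
    then show ?thesis
      unfolding zariski_topology_def using that I(2)
      by (intro topology_generated_by_Basis) blast
  qed
  have V: "openin ?Z (V f c)" if "f \<in> I" "c \<in> C" for f c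
  proof (cases "act f a = c")
    case True
    then show ?thesis using X by (simp add: V_def)
  next
    case False
    then have "V f c = {x \<in> X. act f x \<noteq> c}" by (auto simp: V_def)
    then show ?thesis
      unfolding zariski_topology_def using that I(2) C(2)
      by (intro topology_generated_by_Basis) blast
  qed
  \<comment> \<open>Inserting \<open>X\<close> keeps the family nonempty and its intersection inside
    \<open>X\<close>.\<close>
  define \<W> where "\<W> = insert X (case_prod U ` (I \<times> I) \<union> case_prod V ` (I \<times> C))"
  have "openin ?Z (\<Inter>\<W>)"
    using I(1) C(1) X U V by (intro openin_Inter) (auto simp: \<W>_def)
  moreover have "a \<in> \<Inter>\<W>"
    using assms(1) by (auto simp: \<W>_def U_def V_def)
  ultimately obtain x where x: "x \<in> \<Inter>\<W>" "x \<noteq> a"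
    using assms(2) by (metis insertI1 insert_absorb is_singletonI' is_singleton_the_elem singletonD)
  then have "x \<in> X - {a}" "\<And>f g. f \<in> I \<Longrightarrow> g \<in> I \<Longrightarrow> x \<in> U f g"
      "\<And>f c. f \<in> I \<Longrightarrow> c \<in> C \<Longrightarrow> x \<in> V f c"
    by (auto simp: \<W>_def)
  then show ?thesis
    unfolding U_def V_def by blast
qed

lemma ex_generic_sequence:
  assumes count: "countable (carrier G)"
    and nd: "zariski_topology G X act \<noteq> discrete_topology X"
  shows "\<exists>e a s. generic_sequence G X act e a s"
proof -
  obtain a where a: "a \<in> X" "\<not> openin (zariski_topology G X act) {a}"
    using nd topspace_zariski by (metis discrete_topology_unique)
  define e where "e n = (case n of 0 \<Rightarrow> \<one> | Suc k \<Rightarrow> from_nat_into (carrier G) k)" for n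
  have ne: "carrier G \<noteq> {}" using one_closed by blast
  have e_in: "e n \<in> carrier G" for n
    using from_nat_into[OF ne] by (simp add: e_def split: nat.split)
  have range_e: "range e = carrier G"
  proof
    show "carrier G \<subseteq> range e"
    proof
      fix g assume "g \<in> carrier G"
      then obtain k where "from_nat_into (carrier G) k = g"
        using from_nat_into_surj count by metis
      then have "e (Suc k) = g" by (simp add: e_def)
      then show "g \<in> range e" by blast
    qed
  qed (use e_in in blast)
  \<comment> \<open>The values that \<open>s n\<close> must avoid involve only terms
    \<open>s m\<close> with \<open>m < n\<close>, so the choice can proceed by well-founded
    recursion.\<close>
  define C where "C s n = (\<lambda>j. act (e j) a) ` {..n} \<union>
    (\<lambda>(j, m). act (e j) (s m)) ` ({..n} \<times> {..<n})" for s :: "nat \<Rightarrow> 'x" and n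
  define P where "P s n x \<longleftrightarrow> x \<in> X - {a} \<and>
    (\<forall>f\<in>e ` {..n}. \<forall>g\<in>e ` {..n}. act f x = act g x \<longrightarrow> act f a = act g a) \<and>
    (\<forall>f\<in>e ` {..n}. \<forall>c\<in>C s n. act f x = c \<longrightarrow> act f a = c)" for s :: "nat \<Rightarrow> 'x" and n x
  have "\<exists>s. \<forall>n. P s n (s n)"
  proof (rule dependent_wellorder_choice)
    fix r :: 'x and s t :: "nat \<Rightarrow> 'x" and n
    assume "\<And>m. m < n \<Longrightarrow> s m = t m"
    then have "(\<lambda>(j, m). act (e j) (s m)) ` ({..n} \<times> {..<n}) =
        (\<lambda>(j, m). act (e j) (t m)) ` ({..n} \<times> {..<n})"
      by (intro image_cong) auto
    then have "C s n = C t n" by (simp only: C_def)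
    then show "P s n r = P t n r" by (simp add: P_def)
  next
    fix n :: nat and s :: "nat \<Rightarrow> 'x"
    assume "\<And>m. m < n \<Longrightarrow> P s m (s m)"
    then have "C s n \<subseteq> X"
      using a(1) e_in act_closed by (auto simp: C_def P_def)
    moreover have "finite (C s n)" by (simp add: C_def)
    ultimately show "\<exists>x. P s n x"
      using zariski_nonisolated[OF a, of "e ` {..n}" "C s n"] e_in unfolding P_def by blast
  qed
  then obtain s where s: "\<And>n. P s n (s n)" by blast
  have "generic_sequence G X act e a s"
  proof unfold_locales
    show "range e = carrier G" "a \<in> X" by (fact range_e a(1))+
    show "e 0 = \<one>" by (simp add: e_def)
    show "s n \<in> X" "s n \<noteq> a" for n using s[of n] by (auto simp: P_def)
    show "act (e i) a = act (e j) a"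
      if "i \<le> n" "j \<le> n" "act (e i) (s n) = act (e j) (s n)" for i j n
      using s[of n] that unfolding P_def by blast
    show "act (e i) a = act (e j) a"
      if "i \<le> n" "j \<le> n" "act (e i) (s n) = act (e j) a" for i j n
    proof -
      have "act (e j) a \<in> C s n" using that(2) by (auto simp: C_def)
      then show ?thesis using s[of n] that unfolding P_def by blast
    qed
    show "act (e i) a = act (e j) (s m)"
      if "i \<le> n" "j \<le> n" "m < n" "act (e i) (s n) = act (e j) (s m)" for i j n m
    proof -
      have "act (e j) (s m) \<in> C s n" using that(2,3) by (auto simp: C_def)
      then show ?thesis using s[of n] that unfolding P_def by blast
    qed
  qed
  then show ?thesis by blast
qed

text \<open>In a Hausdorff space equalizers of continuous maps and preimages of points are closed,
  so all subbasic Zariski sets are open in \<open>T\<close>.\<close>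

lemma zariski_openin_Hausdorff:
  assumes T: "act_topology G X act T" "Hausdorff_space T"
    and U: "openin (zariski_topology G X act) U"
  shows "openin T U"
proof (rule generate_topology_on_coarsest[OF istopology_openin])
  show "generate_topology_on (insert X
      ({{x \<in> X. act f x \<noteq> act g x} | f g. f \<in> carrier G \<and> g \<in> carrier G} \<union>
       {{x \<in> X. act f x \<noteq> c} | f c. f \<in> carrier G \<and> c \<in> X})) U"
    using U by (simp add: zariski_topology_def openin_topology_generated_by_iff)
  have top: "topspace T = X" and cont: "\<And>g. g \<in> carrier G \<Longrightarrow> continuous_map T T (act g)"
    using T(1) by (auto simp: act_topology_def)
  have fg: "openin T {x \<in> X. act f x \<noteq> act g x}" if "f \<in> carrier G" "g \<in> carrier G" for f g
  proof -
    have "closedin T {x \<in> topspace T. act f x = act g x}"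
      using that cont T(2) by (intro closedin_continuous_maps_eq) auto
    then have "openin T (X - {x \<in> X. act f x = act g x})"
      by (auto simp: top closedin_def)
    moreover have "X - {x \<in> X. act f x = act g x} = {x \<in> X. act f x \<noteq> act g x}" by blast
    ultimately show ?thesis by simp
  qed
  have fc: "openin T {x \<in> X. act f x \<noteq> c}" if "f \<in> carrier G" "c \<in> X" for f c
  proof -
    have "closedin T {c}"
      using T(2) that(2) by (simp add: top closedin_Hausdorff_singleton)
    then have "closedin T {x \<in> topspace T. act f x \<in> {c}}"
      using cont that(1) closedin_continuous_map_preimage by blast
    then have "openin T (X - {x \<in> X. act f x = c})"
      by (auto simp: top closedin_def)
    moreover have "X - {x \<in> X. act f x = c} = {x \<in> X. act f x \<noteq> c}" by blast
    ultimately show ?thesis by simp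
  qed
  have "openin T X" using top by (metis openin_topspace)
  then show "openin T S" if "S \<in> insert X
      ({{x \<in> X. act f x \<noteq> act g x} | f g. f \<in> carrier G \<and> g \<in> carrier G} \<union>
       {{x \<in> X. act f x \<noteq> c} | f c. f \<in> carrier G \<and> c \<in> X})" for S
    using that fg fc by blast
qed

lemma zariski_nondiscrete:
  assumes "act_topology G X act T" "Hausdorff_space T" "T \<noteq> discrete_topology X"
  shows "zariski_topology G X act \<noteq> discrete_topology X"
proof
  assume "zariski_topology G X act = discrete_topology X"
  then have "\<forall>x\<in>X. openin T {x}"
    using zariski_openin_Hausdorff[OF assms(1,2)] by simp
  then show False
    using assms(1,3) by (metis act_topology_def discrete_topology_unique)
qed

end

section \<open>Many free filters on the natural numbers\<close>

text \<open>The path of \<open>r\<close> through the binary tree of finite bit lists, coded by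
  natural numbers.\<close>

definition branch :: "nat set \<Rightarrow> nat set"
  where "branch r = range (\<lambda>n. to_nat (map (\<lambda>i. i \<in> r) [0..<n]))"

lemma infinite_branch: "infinite (branch r)"
  unfolding branch_def
proof (rule range_inj_infinite, rule injI)
  fix m n assume "to_nat (map (\<lambda>i. i \<in> r) [0..<m]) = to_nat (map (\<lambda>i. i \<in> r) [0..<n])"
  then have "length (map (\<lambda>i. i \<in> r) [0..<m]) = length (map (\<lambda>i. i \<in> r) [0..<n])"
    by (simp only: to_nat_split)
  then show "m = n" by simp
qed

text \<open>Common nodes have equal length, and beyond a place \<open>k\<close> where
  \<open>q\<close> and \<open>r\<close> differ the lists differ at position
  \<open>k\<close>.\<close>

lemma branch_almost_disjoint:
  assumes "q \<noteq> r"
  shows "finite (branch q \<inter> branch r)"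
proof -
  obtain k where k: "k \<in> q \<longleftrightarrow> k \<notin> r" using assms by blast
  have "branch q \<inter> branch r \<subseteq> (\<lambda>n. to_nat (map (\<lambda>i. i \<in> q) [0..<n])) ` {..k}"
  proof
    fix x assume "x \<in> branch q \<inter> branch r"
    then obtain m n where m: "x = to_nat (map (\<lambda>i. i \<in> q) [0..<m])"
      and n: "x = to_nat (map (\<lambda>i. i \<in> r) [0..<n])"
      unfolding branch_def by blast
    then have eq: "map (\<lambda>i. i \<in> q) [0..<m] = map (\<lambda>i. i \<in> r) [0..<n]" by simp
    then have "m = n" by (metis diff_zero length_map length_upt)
    have "m \<le> k"
    proof (rule ccontr)
      assume "\<not> m \<le> k"
      then have "map (\<lambda>i. i \<in> q) [0..<m] ! k = (k \<in> q)" "map (\<lambda>i. i \<in> r) [0..<n] ! k = (k \<in> r)"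
        using \<open>m = n\<close> by auto
      then show False using eq k by simp
    qed
    then show "x \<in> (\<lambda>n. to_nat (map (\<lambda>i. i \<in> q) [0..<n])) ` {..k}" using m by blast
  qed
  then show ?thesis using finite_subset by blast
qed

text \<open>As a family of sets, a supremum of filters is their intersection.\<close>

definition branch_filter :: "nat set set \<Rightarrow> nat filter"
  where "branch_filter S = (SUP r\<in>S. inf sequentially (principal (branch r)))"

lemma eventually_branch_filter:
  "eventually P (branch_filter S) \<longleftrightarrow> (\<forall>r\<in>S. finite {n \<in> branch r. \<not> P n})"
  by (simp add: branch_filter_def eventually_Sup eventually_inf_principal
      eventually_cofinite flip: cofinite_eq_sequentially)

lemma branch_filter_le: "branch_filter S \<le> sequentially"
  unfolding branch_filter_def by (intro SUP_least) simp

lemma branch_filter_neq_bot: "S \<noteq> {} \<Longrightarrow> branch_filter S \<noteq> bot"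
  unfolding eventually_False[symmetric] eventually_branch_filter by (auto simp: infinite_branch)

text \<open>Other branches meet \<open>branch r\<close> in a finite set only, while
  \<open>branch r\<close> is infinite. Thus the filter determines \<open>S\<close>.\<close>

lemma eventually_not_in_branch: "(\<forall>\<^sub>F n in branch_filter S. n \<notin> branch r) \<longleftrightarrow> r \<notin> S"
proof -
  have "finite {n \<in> branch q. \<not> n \<notin> branch r} \<longleftrightarrow> q \<noteq> r" for q
    using infinite_branch[of r] branch_almost_disjoint[of q r]
    by (cases "q = r") (auto simp: Int_def)
  then show ?thesis by (auto simp: eventually_branch_filter)
qed

lemma ex_many_free_filters:
  "\<exists>\<F> :: nat filter set. \<F> \<approx> Pow (Pow (UNIV :: nat set)) \<and>
    (\<forall>F\<in>\<F>. F \<le> sequentially \<and> F \<noteq> bot)"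
proof -
  \<comment> \<open>Adjoining \<open>{}\<close> to a copy of \<open>S\<close> not containing it keeps the filter proper for \<open>S = {}\<close>.\<close>
  define c :: "nat set \<Rightarrow> nat set" where "c r = insert 0 (Suc ` r)" for r
  have "inj c"
    by (rule injI) (auto simp: c_def inj_image_eq_iff)
  define \<Phi> where "\<Phi> S = branch_filter (insert {} (c ` S))" for S
  have "inj \<Phi>"
  proof (rule injI)
    fix S S' assume "\<Phi> S = \<Phi> S'"
    then have "insert {} (c ` S) = insert {} (c ` S')"
      unfolding \<Phi>_def using eventually_not_in_branch by (metis subsetI subset_antisym)
    moreover have "{} \<notin> c ` S" for S by (auto simp: c_def)
    ultimately have "c ` S = c ` S'" by (metis insert_ident)
    then show "S = S'" using \<open>inj c\<close> by (simp add: inj_image_eq_iff)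
  qed
  then have "range \<Phi> \<approx> (UNIV :: nat set set set)"
    by (rule inj_on_image_eqpoll_self)
  moreover have "\<forall>F\<in>range \<Phi>. F \<le> sequentially \<and> F \<noteq> bot"
    by (auto simp: \<Phi>_def branch_filter_le branch_filter_neq_bot)
  ultimately show ?thesis
    by (intro exI[of _ "range \<Phi>"]) simp
qed

section \<open>Many hereditarily normal topologies, and the equivalence\<close>

lemma (in generic_sequence) ex_many_hereditarily_normal:
  "\<exists>\<T>. \<T> \<approx> Pow (Pow (UNIV :: nat set)) \<and>
    (\<forall>T\<in>\<T>. act_topology G X act T \<and> T \<noteq> discrete_topology X \<and> hereditarily_normal T)"
proof -
  obtain \<F> :: "nat filter set" where \<F>: "\<F> \<approx> Pow (Pow (UNIV :: nat set))"
      "\<And>F. F \<in> \<F> \<Longrightarrow> F \<le> sequentially \<and> F \<noteq> bot"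
    using ex_many_free_filters by blast
  have "T ` \<F> \<approx> \<F>"
    using inj_on_T \<F>(2) by (intro inj_on_image_eqpoll_self) (auto elim: inj_on_subset)
  then have "T ` \<F> \<approx> Pow (Pow (UNIV :: nat set))"
    using \<F>(1) eqpoll_trans by blast
  moreover have "act_topology G X act (T F) \<and> T F \<noteq> discrete_topology X \<and> hereditarily_normal (T F)"
    if "F \<in> \<F>" for F
    using \<F>(2)[OF that] a_in s_in s_ne
    by (simp add: act_topology_convergence_topology convergence_topology_nondiscrete hereditarily_normal_T)
  ultimately show ?thesis
    by (intro exI[of _ "T ` \<F>"] conjI ballI) auto
qed

lemma hereditarily_normal_imp_Hausdorff: "hereditarily_normal T \<Longrightarrow> Hausdorff_space T"
  unfolding hereditarily_normal_def by (blast dest: hereditarily_inc intro: normal_t1_imp_Hausdorff_space)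

theorem theorem5p5:
  fixes G :: "('g, 'm) monoid_scheme" and X :: "'x set" and act :: "'g \<Rightarrow> 'x \<Rightarrow> 'x"
  assumes "monoid_act G X act" and "countable (carrier G)"
  defines "cond1 \<equiv> \<exists>T. act_topology G X act T \<and> T \<noteq> discrete_topology X \<and> Hausdorff_space T"
    and "cond2 \<equiv> \<exists>T. act_topology G X act T \<and> T \<noteq> discrete_topology X \<and> metrizable_space T"
    and "cond3 \<equiv> zariski_topology G X act \<noteq> discrete_topology X"
    and "cond4 \<equiv> \<exists>\<T>. \<T> \<approx> Pow (Pow (UNIV :: nat set)) \<and>
      (\<forall>T\<in>\<T>. act_topology G X act T \<and> T \<noteq> discrete_topology X \<and> hereditarily_normal T)"
  shows "(cond1 \<longleftrightarrow> cond2) \<and> (cond2 \<longleftrightarrow> cond3) \<and> (cond3 \<longleftrightarrow> cond4)"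
proof -
  interpret monoid_act G X act by (fact assms(1))
  \<comment> \<open>From \<open>cond3\<close> come \<open>cond2\<close> and \<open>cond4\<close>;
    each of these gives \<open>cond1\<close>, which leads back to \<open>cond3\<close>.\<close>
  have "cond2 \<and> cond4" if c3: cond3
  proof -
    obtain e a s where "generic_sequence G X act e a s"
      using ex_generic_sequence assms(2) c3 unfolding cond3_def by blast
    then interpret generic_sequence G X act e a s .
    show ?thesis
      unfolding cond2_def cond4_def
      by (intro conjI ex_metrizable ex_many_hereditarily_normal)
  qed
  moreover have cond1 if cond2
    using that unfolding cond1_def cond2_def by (blast intro: metrizable_imp_Hausdorff_space)
  moreover have cond3 if cond1
    using that unfolding cond1_def cond3_def by (blast dest: zariski_nondiscrete)
  moreover have cond1 if c4: cond4
  proof -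
    obtain \<T> :: "'x topology set" where \<T>: "\<T> \<approx> Pow (Pow (UNIV :: nat set))"
      "\<forall>T\<in>\<T>. act_topology G X act T \<and> T \<noteq> discrete_topology X \<and> hereditarily_normal T"
      using c4 unfolding cond4_def by blast
    from \<T>(1) have "\<T> \<noteq> {}" 
      by (metis Pow_not_empty eqpoll_empty_iff_empty eqpoll_sym)
    then show ?thesis
      using \<T>(2) hereditarily_normal_imp_Hausdorff unfolding cond1_def by blast
  qed
  ultimately show ?thesis by blast
qed

end
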